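(* Let $G=(U,V,E)$, $w:E\to\mathbb{R}$ with $w_{ij}>0$ for all $(i,j)\in E$, be an assignment game. For every player $q\in U\cup V$: $q$ is paid sometimes (i.e. there is at least one imputation in the core under which $q$ receives strictly positive profit) if and only if $q$ is essential (i.e. $q$ is matched in every maximum weight matching of $G$).
   Context: Assignment game: $G=(U,V,E)$ is a finite bipartite graph with bipartition $U,V$ and edge weights $w_{ij}>0$. The players are the vertices $U\cup V$. The worth $p(S_u\cup S_v)$ of a coalition $S_u\cup S_v$ ($S_u\subseteq U$, $S_v\subseteq V$) is the weight of a maximum weight matching in the subgraph of $G$ induced on $S_u\cup S_v$; the worth of the game is $p(U\cup V)$. An imputation is a function $y:U\cup V\to\mathbb{R}_{\ge 0}$ with $\sum_{q\in U\cup V}y_q=p(U\cup V)$. It is in the core if $\sum_{q\in S_u\cup S_v}y_q\ge p(S_u\cup S_v)$ for every coalition $S_u\cup S_v$. A player $q$ gets paid in a core imputation $y$ if $y_q>0$. Player $q$ is paid sometimes if there is at least one core imputation in which $q$ gets paid. Player $q$ is essential if $q$ is matched in every maximum weight matching in $G$. *)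

theory Defs
  imports Complex_Main
begin

text \<open>An edge is a pair whose first component lies in \<open>U\<close> and whose second component
  lies in \<open>V\<close>, so that simplicity and bipartiteness of the graph amount to
  \<open>E \<subseteq> U \<times> V\<close> with \<open>U\<close> and \<open>V\<close> disjoint. The values of \<open>w\<close> outside \<open>E\<close> are irrelevant.\<close>

locale assignment_game =
  fixes U V :: "'a set" and E :: "('a \<times> 'a) set" and w :: "'a \<times> 'a \<Rightarrow> real"
  assumes finite_U: "finite U"
    and finite_V: "finite V"
    and disjoint: "U \<inter> V = {}"
    and edges: "E \<subseteq> U \<times> V"
    and weight_pos: "\<And>e. e \<in> E \<Longrightarrow> w e > 0"

definition endpoints :: "'a \<times> 'a \<Rightarrow> 'a set" where
  "endpoints e = {fst e, snd e}"

definition matching :: "('a \<times> 'a) set \<Rightarrow> ('a \<times> 'a) set \<Rightarrow> bool" where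
  "matching E M \<longleftrightarrow> M \<subseteq> E \<and> (\<forall>e\<in>M. \<forall>f\<in>M. e \<noteq> f \<longrightarrow> endpoints e \<inter> endpoints f = {})"

definition weight :: "('a \<times> 'a \<Rightarrow> real) \<Rightarrow> ('a \<times> 'a) set \<Rightarrow> real" where
  "weight w M = (\<Sum>e\<in>M. w e)"

definition max_weight_matching ::
    "('a \<times> 'a) set \<Rightarrow> ('a \<times> 'a \<Rightarrow> real) \<Rightarrow> ('a \<times> 'a) set \<Rightarrow> bool" where
  "max_weight_matching E w M \<longleftrightarrow>
     matching E M \<and> (\<forall>M'. matching E M' \<longrightarrow> weight w M' \<le> weight w M)"

definition matched :: "('a \<times> 'a) set \<Rightarrow> 'a \<Rightarrow> bool" where
  "matched M q \<longleftrightarrow> (\<exists>e\<in>M. q \<in> endpoints e)"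

definition induced_edges :: "('a \<times> 'a) set \<Rightarrow> 'a set \<Rightarrow> ('a \<times> 'a) set" where
  "induced_edges E S = {e \<in> E. endpoints e \<subseteq> S}"

definition worth :: "('a \<times> 'a) set \<Rightarrow> ('a \<times> 'a \<Rightarrow> real) \<Rightarrow> 'a set \<Rightarrow> real" where
  "worth E w S = Max (weight w ` {M. matching (induced_edges E S) M})"

text \<open>Only the values of \<open>y\<close> on \<open>U \<union> V\<close> matter in the following definitions.\<close>

definition imputation ::
    "'a set \<Rightarrow> 'a set \<Rightarrow> ('a \<times> 'a) set \<Rightarrow> ('a \<times> 'a \<Rightarrow> real) \<Rightarrow> ('a \<Rightarrow> real) \<Rightarrow> bool" where
  "imputation U V E w y \<longleftrightarrow>
     (\<forall>q\<in>U \<union> V. y q \<ge> 0) \<and> (\<Sum>q\<in>U \<union> V. y q) = worth E w (U \<union> V)"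

definition core ::
    "'a set \<Rightarrow> 'a set \<Rightarrow> ('a \<times> 'a) set \<Rightarrow> ('a \<times> 'a \<Rightarrow> real) \<Rightarrow> ('a \<Rightarrow> real) set" where
  "core U V E w =
     {y. imputation U V E w y \<and>
         (\<forall>Su Sv. Su \<subseteq> U \<longrightarrow> Sv \<subseteq> V \<longrightarrow>
            (\<Sum>q\<in>Su \<union> Sv. y q) \<ge> worth E w (Su \<union> Sv))}"

definition paid_sometimes ::
    "'a set \<Rightarrow> 'a set \<Rightarrow> ('a \<times> 'a) set \<Rightarrow> ('a \<times> 'a \<Rightarrow> real) \<Rightarrow> 'a \<Rightarrow> bool" where
  "paid_sometimes U V E w q \<longleftrightarrow> (\<exists>y\<in>core U V E w. y q > 0)"

definition essential :: "('a \<times> 'a) set \<Rightarrow> ('a \<times> 'a \<Rightarrow> real) \<Rightarrow> 'a \<Rightarrow> bool" where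
  "essential E w q \<longleftrightarrow> (\<forall>M. max_weight_matching E w M \<longrightarrow> matched M q)"

text \<open>The maximum in \<open>worth\<close> ranges over a finite nonempty set, so it is the weight of
  a maximum weight matching of the induced subgraph.\<close>

lemma finite_matchings: "finite E \<Longrightarrow> finite {M. matching E M}"
  by (rule finite_subset[of _ "Pow E"]) (auto simp: matching_def)

lemma matching_empty: "matching E {}"
  by (simp add: matching_def)

lemma (in assignment_game) finite_edges: "finite E"
  using finite_subset[OF edges] finite_U finite_V by blast

lemma (in assignment_game) worth_eq_weight:
  assumes "max_weight_matching (induced_edges E S) w M"
  shows "worth E w S = weight w M"
proof -
  have "finite (induced_edges E S)"
    using finite_edges by (simp add: induced_edges_def)
  then show ?thesis
    using assms unfolding worth_def max_weight_matching_def
    by (intro Max_eqI) (auto simp: finite_matchings)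
qed

lemma (in assignment_game) max_weight_matching_exists:
  "\<exists>M. max_weight_matching (induced_edges E S) w M"
proof -
  let ?A = "{M. matching (induced_edges E S) M}"
  have fin: "finite (weight w ` ?A)"
    using finite_edges by (simp add: induced_edges_def finite_matchings)
  have "weight w ` ?A \<noteq> {}"
    using matching_empty by blast
  with fin have "Max (weight w ` ?A) \<in> weight w ` ?A"
    by (rule Max_in)
  then obtain M where "M \<in> ?A" "weight w M = Max (weight w ` ?A)"
    by force
  then show ?thesis
    using fin unfolding max_weight_matching_def by (metis Max_ge imageI mem_Collect_eq)
qed

end

theory Submission
  imports Defs
begin

text \<open>The core consists of the optimal solutions of the dual linear program: nonnegative vertex
  covers \<open>y\<close> of the edge weights with total \<open>p(U \<union> V)\<close>. In a cover of that total,
  complementary slackness forces \<open>y\<close> to vanish at every vertex missed by some maximum weight matching.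
  Conversely, let \<open>\<delta>\<close> be the loss in worth when \<open>q\<close> is removed from the graph.
  Subtracting \<open>\<delta>\<close> from the weights of all edges at \<open>q\<close> lowers the maximum by exactly \<open>\<delta>\<close>, so an
  optimal cover of the discounted weights becomes one of the original weights by adding \<open>\<delta>\<close> at \<open>q\<close>,
  and \<open>\<delta> > 0\<close> precisely if \<open>q\<close> is essential. Discounting all vertices in turn also proves that
  optimal covers exist: once no vertex is essential, no edge has positive weight (an argument of
  Gallai type), so that \<open>0\<close> is an optimal cover.\<close>

section \<open>Matchings and weak duality\<close>

lemma finite_matching: "finite E \<Longrightarrow> matching E M \<Longrightarrow> finite M"
  unfolding matching_def by (blast intro: finite_subset)

lemma matching_unique:
  "matching E M \<Longrightarrow> e \<in> M \<Longrightarrow> f \<in> M \<Longrightarrow> a \<in> endpoints e \<Longrightarrow> a \<in> endpoints f \<Longrightarrow> e = f"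
  unfolding matching_def by blast

text \<open>Stated outside the locale since it is also applied to discounted weights, which may be
  negative.\<close>

lemma obtain_max_weight_matching:
  assumes "finite E"
  obtains M where "max_weight_matching E w M"
proof -
  have fin: "finite (weight w ` {M. matching E M})"
    using assms by (simp add: finite_matchings)
  moreover have "weight w ` {M. matching E M} \<noteq> {}"
    using matching_empty by blast
  ultimately have "Max (weight w ` {M. matching E M}) \<in> weight w ` {M. matching E M}"
    by (rule Max_in)
  then obtain M where "matching E M" "weight w M = Max (weight w ` {M. matching E M})"
    by force
  with fin have "max_weight_matching E w M"
    unfolding max_weight_matching_def by (metis Max_ge imageI mem_Collect_eq)
  then show ?thesis ..
qed

lemma sum_matched:
  fixes y :: "'a \<Rightarrow> real"
  assumes "finite E" "\<forall>e\<in>E. fst e \<noteq> snd e" "matching E M"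
  shows "sum y {q. matched M q} = (\<Sum>e\<in>M. y (fst e) + y (snd e))"
proof -
  have "sum y (\<Union>e\<in>M. endpoints e) = (\<Sum>e\<in>M. sum y (endpoints e))"
    using assms finite_matching[OF assms(1,3)]
    by (intro sum.UNION_disjoint) (auto simp: matching_def endpoints_def)
  also have "\<dots> = (\<Sum>e\<in>M. y (fst e) + y (snd e))"
  proof (intro sum.cong refl)
    fix e assume "e \<in> M"
    then have "fst e \<noteq> snd e"
      using assms(2,3) by (auto simp: matching_def)
    then show "sum y (endpoints e) = y (fst e) + y (snd e)"
      by (simp add: endpoints_def)
  qed
  also have "(\<Union>e\<in>M. endpoints e) = {q. matched M q}"
    by (auto simp: matched_def)
  finally show ?thesis .
qed

text \<open>Weak duality: the edges of \<open>M\<close> are disjoint, so their cover inequalities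
  add up. Summing over matched vertices only leaves the values at unmatched ones as slack.\<close>

lemma weight_le_sum_matched:
  assumes "finite E" "\<forall>e\<in>E. fst e \<noteq> snd e" "matching E M"
    and "\<forall>e\<in>E. w e \<le> y (fst e) + y (snd e)"
  shows "weight w M \<le> sum y {q. matched M q}"
  unfolding sum_matched[OF assms(1-3)] weight_def
  using assms(3,4) by (intro sum_mono) (auto simp: matching_def)

section \<open>Discounting the edges at one vertex\<close>

definition discount :: "('a \<times> 'a \<Rightarrow> real) \<Rightarrow> 'a \<Rightarrow> real \<Rightarrow> 'a \<times> 'a \<Rightarrow> real" where
  "discount w a \<delta> e = w e - (if a \<in> endpoints e then \<delta> else 0)"

text \<open>At most one edge of a matching contains \<open>a\<close>, so \<open>\<delta>\<close> is
  charged at most once.\<close>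

lemma weight_discount:
  assumes "finite E" "matching E M"
  shows "weight (discount w a \<delta>) M = weight w M - (if matched M a then \<delta> else 0)"
proof -
  have "(\<Sum>e\<in>M. if a \<in> endpoints e then \<delta> else 0) = (if matched M a then \<delta> else 0)"
  proof (cases "matched M a")
    case True
    then obtain f where f: "f \<in> M" "a \<in> endpoints f"
      unfolding matched_def by blast
    have "(\<Sum>e\<in>M. if a \<in> endpoints e then \<delta> else 0) = (\<Sum>e\<in>M. if e = f then \<delta> else 0)"
      using f matching_unique[OF assms(2)] by (intro sum.cong) auto
    with True f finite_matching[OF assms] show ?thesis
      by simp
  qed (auto simp: matched_def intro: sum.neutral)
  then show ?thesis
    unfolding weight_def discount_def by (simp add: sum_subtractf)
qed

text \<open>A matching that covers \<open>a\<close> drops to at most the weight of the best one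
  avoiding \<open>a\<close>, so the latter becomes optimal. That old optima survive keeps
  inessential vertices inessential in the later induction.\<close>

lemma obtain_discount:
  assumes "finite E"
  obtains \<delta> where "\<delta> \<ge> 0" "essential E w a \<Longrightarrow> \<delta> > 0" "\<not> essential E (discount w a \<delta>) a"
    "\<And>M. max_weight_matching E w M \<Longrightarrow> max_weight_matching E (discount w a \<delta>) M"
    "\<And>M N. max_weight_matching E w M \<Longrightarrow> max_weight_matching E (discount w a \<delta>) N
      \<Longrightarrow> weight w M = weight (discount w a \<delta>) N + \<delta>"
proof -
  let ?F = "{e \<in> E. a \<notin> endpoints e}"
  obtain M where M: "max_weight_matching E w M"
    using obtain_max_weight_matching[OF assms] .
  obtain L where L: "max_weight_matching ?F w L"
    using obtain_max_weight_matching[of ?F] assms by auto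
  have L_matching: "matching E L" and L_missing: "\<not> matched L a"
    using L by (auto simp: max_weight_matching_def matching_def matched_def)
  have L_max: "weight w N \<le> weight w L" if "matching E N" "\<not> matched N a" for N
  proof -
    have "matching ?F N"
      using that unfolding matching_def matched_def by blast
    with L show ?thesis
      by (simp add: max_weight_matching_def)
  qed
  define \<delta> where "\<delta> = weight w M - weight w L"
  let ?w = "discount w a \<delta>"
  note wd = weight_discount[OF assms, where a = a and \<delta> = \<delta>]
  have nonneg: "\<delta> \<ge> 0"
    using M L_matching by (simp add: \<delta>_def max_weight_matching_def)
  have "weight w N \<le> weight w M" if "matching E N" for N
    using that M by (simp add: max_weight_matching_def)
  then have "weight ?w N \<le> weight ?w L" if "matching E N" for N
    using that L_max[of N] wd[OF that] wd[OF L_matching] L_missing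
    by (cases "matched N a") (simp_all add: \<delta>_def)
  then have L': "max_weight_matching E ?w L"
    using L_matching by (simp add: max_weight_matching_def)
  have "weight w N = weight ?w K + \<delta>"
    if "max_weight_matching E w N" "max_weight_matching E ?w K" for N K
  proof -
    have "weight w N = weight w M" "weight ?w K = weight ?w L"
      using that M L' by (meson antisym max_weight_matching_def)+
    then show ?thesis
      using wd[OF L_matching] L_missing by (simp add: \<delta>_def)
  qed
  moreover have "max_weight_matching E ?w N" if N: "max_weight_matching E w N" for N
  proof -
    have "matching E N" "weight w N \<ge> weight w M"
      using N M by (simp_all add: max_weight_matching_def)
    then have "weight ?w N \<ge> weight ?w L"
      using wd[of N] wd[OF L_matching] L_missing nonneg by (simp add: \<delta>_def)
    with L' \<open>matching E N\<close> show ?thesis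
      unfolding max_weight_matching_def by force
  qed
  \<comment> \<open>With \<open>\<delta> = 0\<close> the matching \<open>L\<close>, which misses
    \<open>a\<close>, would be maximum for \<open>w\<close>.\<close>
  moreover have "\<delta> > 0" if "essential E w a"
  proof (rule ccontr)
    assume "\<not> \<delta> > 0"
    with M L_matching have "max_weight_matching E w L"
      unfolding \<delta>_def max_weight_matching_def by force
    with that L_missing show False
      by (simp add: essential_def)
  qed
  moreover have "\<not> essential E ?w a"
    using L' L_missing by (auto simp: essential_def)
  ultimately show ?thesis
    using nonneg that by blast
qed

section \<open>Exchange along an alternating path\<close>

text \<open>The vertices of the alternating path that starts at \<open>i \<in> U\<close> and follows the edges of \<open>N\<close>
  from \<open>U\<close> to \<open>V\<close> and those of \<open>M\<close> from \<open>V\<close> to \<open>U\<close>.\<close>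

inductive_set alternating :: "('a \<times> 'a) set \<Rightarrow> ('a \<times> 'a) set \<Rightarrow> 'a \<Rightarrow> 'a set"
  for M N i where
  start: "i \<in> alternating M N i"
| forward: "u \<in> alternating M N i \<Longrightarrow> (u, v) \<in> N \<Longrightarrow> v \<in> alternating M N i"
| backward: "v \<in> alternating M N i \<Longrightarrow> (u, v) \<in> M \<Longrightarrow> u \<in> alternating M N i"

text \<open>Each edge lies wholly inside or wholly outside \<open>C\<close>, so the part of
  \<open>M\<close> kept inside cannot touch the part of \<open>N\<close> kept outside.\<close>

lemma matching_exchange:
  assumes "matching E M" "matching E N"
    and "\<And>e. e \<in> M \<union> N \<Longrightarrow> fst e \<in> C \<longleftrightarrow> snd e \<in> C"
  shows "matching E ({e \<in> M. fst e \<in> C} \<union> {e \<in> N. fst e \<notin> C})"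
proof -
  let ?K = "{e \<in> M. fst e \<in> C} \<union> {e \<in> N. fst e \<notin> C}"
  have side: "endpoints e \<subseteq> C \<and> e \<in> M \<or> endpoints e \<inter> C = {} \<and> e \<in> N" if "e \<in> ?K" for e
    using that assms(3)[of e] by (auto simp: endpoints_def)
  have "endpoints e \<inter> endpoints f = {}" if "e \<in> ?K" "f \<in> ?K" "e \<noteq> f" for e f
    using side[OF that(1)] side[OF that(2)] that(3) assms(1,2) unfolding matching_def by blast
  moreover have "?K \<subseteq> E"
    using assms(1,2) unfolding matching_def by blast
  ultimately show ?thesis
    unfolding matching_def by blast
qed

text \<open>The two complementary exchanges use the edges of \<open>M\<close> and \<open>N\<close>
  with the same multiplicity, so a loss in one is a gain in the other.\<close>

lemma weight_exchange:
  assumes "finite M" "finite N"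
  shows "weight w ({e \<in> M. fst e \<in> C} \<union> {e \<in> N. fst e \<notin> C})
       + weight w ({e \<in> N. fst e \<in> C} \<union> {e \<in> M. fst e \<notin> C}) = weight w M + weight w N"
proof -
  have split: "weight w ({e \<in> A. fst e \<in> C} \<union> {e \<in> B. fst e \<notin> C})
      = weight w {e \<in> A. fst e \<in> C} + weight w {e \<in> B. fst e \<notin> C}"
    if "finite A" "finite B" for A B
    unfolding weight_def using that by (intro sum.union_disjoint) auto
  have "weight w A = weight w {e \<in> A. fst e \<in> C} + weight w {e \<in> A. fst e \<notin> C}"
    if "finite A" for A
  proof -
    have "A = {e \<in> A. fst e \<in> C} \<union> {e \<in> A. fst e \<notin> C}"
      by blast
    with split[OF that that] show ?thesis
      by simp
  qed
  from this[OF assms(1)] this[OF assms(2)] show ?thesis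
    by (simp add: split assms)
qed

text \<open>If \<open>M\<close> misses \<open>i\<close> and \<open>N\<close> misses \<open>j\<close>, exchanging \<open>M\<close> and \<open>N\<close> along the alternating path
  from \<open>i\<close> gives a maximum weight matching missing both ends of the edge \<open>(i, j)\<close>, because the path
  reaches vertices of \<open>V\<close> only through edges of \<open>N\<close> and hence avoids \<open>j\<close>.\<close>

lemma inessential_edge_weight:
  assumes fin: "finite E" and bip: "E \<subseteq> U \<times> V" "U \<inter> V = {}"
    and ij: "(i, j) \<in> E" "\<not> essential E w i" "\<not> essential E w j"
  shows "w (i, j) \<le> 0"
proof -
  obtain M where M: "max_weight_matching E w M" "\<not> matched M i"
    using ij by (auto simp: essential_def)
  obtain N where N: "max_weight_matching E w N" "\<not> matched N j"
    using ij by (auto simp: essential_def)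
  have mM: "matching E M" and mN: "matching E N"
    using M N by (auto simp: max_weight_matching_def)
  define C where "C = alternating M N i"
  have "i \<in> U" "j \<in> V" "j \<notin> U"
    using ij bip by auto
  have sides: "a \<in> U \<and> b \<in> V \<and> a \<notin> V \<and> b \<notin> U" if "(a, b) \<in> M \<union> N" for a b
  proof -
    have "(a, b) \<in> U \<times> V"
      using that mM mN bip(1) unfolding matching_def by blast
    with bip(2) show ?thesis
      by blast
  qed
  \<comment> \<open>After the start, only \<open>backward\<close> enters \<open>U\<close>; only
    \<open>forward\<close> enters \<open>V\<close>.\<close>
  have C_U: "u = i \<or> (\<exists>v\<in>C. (u, v) \<in> M)" if "u \<in> C" "u \<in> U" for u
    using that(1) unfolding C_def
    by (cases rule: alternating.cases) (use that(2) sides in blast)+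
  have C_V: "\<exists>u\<in>C. (u, v) \<in> N" if "v \<in> C" "v \<in> V" for v
    using that(1) unfolding C_def
    by (cases rule: alternating.cases) (use that(2) sides \<open>i \<in> U\<close> bip in blast)+
  \<comment> \<open>From \<open>u\<close> to \<open>v\<close> the path is traced back:
    \<open>u\<close> differs from \<open>i\<close>, so it was entered through an edge of
    \<open>M\<close>, which must be \<open>(u, v)\<close>.\<close>
  have closed_M: "u \<in> C \<longleftrightarrow> v \<in> C" if uv: "(u, v) \<in> M" for u v
  proof
    assume "u \<in> C"
    moreover have "u \<noteq> i"
      using M(2) uv by (force simp: matched_def endpoints_def)
    ultimately obtain v' where "v' \<in> C" "(u, v') \<in> M"
      using C_U sides[of u v] uv by auto
    with matching_unique[OF mM uv, of "(u, v')" u] show "v \<in> C"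
      by (auto simp: endpoints_def)
  qed (use uv in \<open>auto simp: C_def intro: alternating.backward\<close>)
  have closed_N: "u \<in> C \<longleftrightarrow> v \<in> C" if uv: "(u, v) \<in> N" for u v
  proof
    assume "v \<in> C"
    then obtain u' where "u' \<in> C" "(u', v) \<in> N"
      using C_V sides[of u v] uv by auto
    with matching_unique[OF mN uv, of "(u', v)" v] show "u \<in> C"
      by (auto simp: endpoints_def)
  qed (use uv in \<open>auto simp: C_def intro: alternating.forward\<close>)
  have closed: "fst e \<in> C \<longleftrightarrow> snd e \<in> C" if "e \<in> M \<union> N" for e
    using that closed_M[of "fst e" "snd e"] closed_N[of "fst e" "snd e"] by auto
  have "i \<in> C"
    by (simp add: C_def alternating.start)
  have "j \<notin> C"
    using C_V[OF _ \<open>j \<in> V\<close>] N(2) by (force simp: matched_def endpoints_def)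
  \<comment> \<open>Taking \<open>M\<close> inside \<open>C\<close> frees \<open>i\<close>, taking
    \<open>N\<close> outside frees \<open>j\<close>. The complementary \<open>?L\<close> serves to
    bound the weight of \<open>?K\<close> from below.\<close>
  let ?K = "{e \<in> M. fst e \<in> C} \<union> {e \<in> N. fst e \<notin> C}"
  let ?L = "{e \<in> N. fst e \<in> C} \<union> {e \<in> M. fst e \<notin> C}"
  have mK: "matching E ?K"
    by (rule matching_exchange[OF mM mN closed])
  have mL: "matching E ?L"
    by (rule matching_exchange[OF mN mM]) (rule closed, simp only: Un_commute)
  have "weight w ?K + weight w ?L = weight w M + weight w N"
    by (rule weight_exchange) (use fin mM mN finite_matching in auto)
  moreover have "weight w ?L \<le> weight w M"
    using M mL by (simp add: max_weight_matching_def)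
  ultimately have "weight w N \<le> weight w ?K"
    by simp
  have miss: "i \<notin> endpoints e \<and> j \<notin> endpoints e" if "e \<in> ?K" for e
  proof -
    have "endpoints e \<subseteq> C \<and> e \<in> M \<or> endpoints e \<inter> C = {} \<and> e \<in> N"
      using that closed[of e] by (auto simp: endpoints_def)
    then show ?thesis
      using M(2) N(2) \<open>i \<in> C\<close> \<open>j \<notin> C\<close> unfolding matched_def by blast
  qed
  have "endpoints e \<inter> endpoints (i, j) = {}" if "e \<in> ?K" for e
    using miss[OF that] by (simp add: endpoints_def)
  then have "matching E (insert (i, j) ?K)"
    using mK ij(1) unfolding matching_def by (simp add: Int_commute)
  with N have "weight w (insert (i, j) ?K) \<le> weight w N"
    by (simp add: max_weight_matching_def)
  moreover have "weight w (insert (i, j) ?K) = w (i, j) + weight w ?K"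
    unfolding weight_def using miss[of "(i, j)"] finite_matching[OF fin mK]
    by (intro sum.insert) (auto simp: endpoints_def)
  ultimately show ?thesis
    using \<open>weight w N \<le> weight w ?K\<close> by simp
qed

section \<open>Existence of optimal covers\<close>

text \<open>Optimality is encoded as attaining the bound of weak duality rather than as minimality
  among covers, so existence amounts to strong duality (Egervary's theorem).\<close>

definition optimal_cover ::
    "'a set \<Rightarrow> ('a \<times> 'a) set \<Rightarrow> ('a \<times> 'a \<Rightarrow> real) \<Rightarrow> ('a \<Rightarrow> real) \<Rightarrow> bool" where
  "optimal_cover W E w y \<longleftrightarrow>
     (\<forall>q\<in>W. y q \<ge> 0) \<and> (\<forall>e\<in>E. w e \<le> y (fst e) + y (snd e)) \<and>
     (\<forall>M. max_weight_matching E w M \<longrightarrow> sum y W = weight w M)"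

text \<open>Raising \<open>y a\<close> by \<open>\<delta>\<close> repays the discount at every edge
  through \<open>a\<close>, and the total grows by as much as the maximum weight.\<close>

lemma optimal_cover_discount:
  assumes "finite W" "finite E" "a \<in> W" "\<delta> \<ge> 0" "optimal_cover W E (discount w a \<delta>) y"
    and "\<And>M N. max_weight_matching E w M \<Longrightarrow> max_weight_matching E (discount w a \<delta>) N
      \<Longrightarrow> weight w M = weight (discount w a \<delta>) N + \<delta>"
  shows "optimal_cover W E w (y(a := y a + \<delta>))"
proof -
  have "sum (y(a := y a + \<delta>)) W = sum y W + \<delta>"
    using assms(1,3) by (simp add: sum.remove[of W a])
  moreover obtain N where "max_weight_matching E (discount w a \<delta>) N"
    using obtain_max_weight_matching[OF assms(2)] .
  ultimately have "sum (y(a := y a + \<delta>)) W = weight w M" if "max_weight_matching E w M" for M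
    using assms(5,6) that by (simp add: optimal_cover_def)
  moreover have "w e \<le> (y(a := y a + \<delta>)) (fst e) + (y(a := y a + \<delta>)) (snd e)" if "e \<in> E" for e
  proof -
    have "discount w a \<delta> e \<le> y (fst e) + y (snd e)"
      using assms(5) that by (simp add: optimal_cover_def)
    then show ?thesis
      using assms(4) by (auto simp: discount_def endpoints_def split: if_splits)
  qed
  ultimately show ?thesis
    using assms(4,5) by (auto simp: optimal_cover_def)
qed

lemma optimal_cover_exists:
  assumes fin: "finite U" "finite V" and bip: "E \<subseteq> U \<times> V" "U \<inter> V = {}"
  shows "\<exists>y. optimal_cover (U \<union> V) E w y"
proof -
  have finE: "finite E"
    using fin bip(1) finite_subset by blast
  \<comment> \<open>\<open>A\<close> contains all essential vertices; \<open>w\<close> is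
    generalised since each induction step passes to discounted weights.\<close>
  have "\<exists>y. optimal_cover (U \<union> V) E w y"
    if "finite A" "A \<subseteq> U \<union> V" "\<forall>q\<in>U \<union> V - A. \<not> essential E w q" for A w
    using that
  proof (induction A arbitrary: w)
    case (empty w)
    have nonpos: "w e \<le> 0" if "e \<in> E" for e
    proof (cases e)
      case (Pair i j)
      then show ?thesis
        using inessential_edge_weight[OF finE bip, of i j w] that empty bip(1) by blast
    qed
    have "weight w M = 0" if M: "max_weight_matching E w M" for M
    proof (rule antisym)
      show "weight w M \<le> 0"
        unfolding weight_def using M nonpos
        by (intro sum_nonpos) (auto simp: max_weight_matching_def matching_def)
      show "0 \<le> weight w M"
        using M matching_empty by (force simp: max_weight_matching_def weight_def)
    qed
    with nonpos have "optimal_cover (U \<union> V) E w (\<lambda>_. 0)"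
      by (simp add: optimal_cover_def)
    then show ?case
      by blast
  next
    case (insert a A w)
    obtain \<delta> where \<delta>: "\<delta> \<ge> 0" "\<not> essential E (discount w a \<delta>) a"
      "\<And>M. max_weight_matching E w M \<Longrightarrow> max_weight_matching E (discount w a \<delta>) M"
      "\<And>M N. max_weight_matching E w M \<Longrightarrow> max_weight_matching E (discount w a \<delta>) N
        \<Longrightarrow> weight w M = weight (discount w a \<delta>) N + \<delta>"
      using obtain_discount[OF finE] by metis
    \<comment> \<open>\<open>a\<close> has become inessential; any other vertex outside
      \<open>A\<close> is missed by an old optimum, which is still optimal.\<close>
    have "\<forall>q\<in>U \<union> V - A. \<not> essential E (discount w a \<delta>) q"
      using insert.prems(2) \<delta>(2,3) unfolding essential_def by blast
    then obtain y where "optimal_cover (U \<union> V) E (discount w a \<delta>) y"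
      using insert.IH insert.prems(1) by blast
    then have "optimal_cover (U \<union> V) E w (y(a := y a + \<delta>))"
      by (intro optimal_cover_discount) (use fin finE insert.prems(1) \<delta> in auto)
    then show ?case
      by blast
  qed
  from this[of "U \<union> V"] show ?thesis
    using fin by simp
qed

section \<open>The core and optimal covers\<close>

context assignment_game
begin

lemma edge_ends_distinct: "\<forall>e\<in>E. fst e \<noteq> snd e"
  using edges disjoint by auto

lemma induced_edges_all: "induced_edges E (U \<union> V) = E"
  using edges by (auto simp: induced_edges_def endpoints_def)

text \<open>Weak duality in the induced subgraph bounds a coalition's worth by the shares of its
  matched members; the other shares are nonnegative.\<close>

lemma optimal_cover_in_core:
  assumes y: "optimal_cover (U \<union> V) E w y"
  shows "y \<in> core U V E w"
proof -
  obtain M where "max_weight_matching (induced_edges E (U \<union> V)) w M"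
    using max_weight_matching_exists by blast
  then have "imputation U V E w y"
    using y worth_eq_weight
    by (auto simp: imputation_def optimal_cover_def induced_edges_all)
  moreover have "worth E w (Su \<union> Sv) \<le> sum y (Su \<union> Sv)" if S: "Su \<subseteq> U" "Sv \<subseteq> V" for Su Sv
  proof -
    let ?F = "induced_edges E (Su \<union> Sv)"
    have F: "?F \<subseteq> E"
      by (auto simp: induced_edges_def)
    obtain M where M: "max_weight_matching ?F w M"
      using max_weight_matching_exists by blast
    then have mM: "matching ?F M"
      by (simp add: max_weight_matching_def)
    have "weight w M \<le> sum y {q. matched M q}"
      by (rule weight_le_sum_matched[OF finite_subset[OF F finite_edges] _ mM])
        (use F y edge_ends_distinct in \<open>auto simp: optimal_cover_def\<close>)
    also have "\<dots> \<le> sum y (Su \<union> Sv)"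
    proof (rule sum_mono2)
      show "finite (Su \<union> Sv)"
        using S finite_U finite_V by (auto intro: finite_subset)
      show "{q. matched M q} \<subseteq> Su \<union> Sv"
        using mM by (auto simp: matching_def matched_def induced_edges_def)
      show "0 \<le> y b" if "b \<in> Su \<union> Sv - {q. matched M q}" for b
        using that S y by (auto simp: optimal_cover_def)
    qed
    finally show ?thesis
      by (simp add: worth_eq_weight[OF M])
  qed
  ultimately show ?thesis
    by (simp add: core_def)
qed

text \<open>The edge alone is a matching in the coalition of its two ends.\<close>

lemma core_covers_edge:
  assumes y: "y \<in> core U V E w" and ij: "(i, j) \<in> E"
  shows "w (i, j) \<le> y i + y j"
proof -
  have mem: "i \<in> U" "j \<in> V"
    using ij edges by auto
  let ?F = "induced_edges E ({i} \<union> {j})"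
  obtain M where M: "max_weight_matching ?F w M"
    using max_weight_matching_exists by blast
  have "matching ?F {(i, j)}"
    using ij by (auto simp: matching_def induced_edges_def endpoints_def)
  with M have "weight w {(i, j)} \<le> weight w M"
    by (simp add: max_weight_matching_def)
  also have "\<dots> = worth E w ({i} \<union> {j})"
    using worth_eq_weight[OF M] by simp
  also have "\<dots> \<le> sum y ({i} \<union> {j})"
  proof -
    have "{i} \<subseteq> U" "{j} \<subseteq> V"
      using mem by auto
    with y show ?thesis
      unfolding core_def by blast
  qed
  also have "\<dots> = y i + y j"
    using mem disjoint by (subst sum.union_disjoint) auto
  finally show ?thesis
    by (simp add: weight_def)
qed

lemma paid_sometimes_imp_essential:
  assumes q: "q \<in> U \<union> V" and paid: "paid_sometimes U V E w q"
  shows "essential E w q"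
  unfolding essential_def
proof (intro allI impI, rule ccontr)
  fix M
  assume M: "max_weight_matching E w M" and unmatched: "\<not> matched M q"
  have mM: "matching E M"
    using M by (simp add: max_weight_matching_def)
  obtain y where y: "y \<in> core U V E w" "y q > 0"
    using paid by (auto simp: paid_sometimes_def)
  have imp: "\<forall>q\<in>U \<union> V. y q \<ge> 0" "sum y (U \<union> V) = weight w M"
    using y(1) worth_eq_weight[of "U \<union> V" M] M
    by (auto simp: core_def imputation_def induced_edges_all)
  have "weight w M \<le> sum y {q. matched M q}"
    by (rule weight_le_sum_matched[OF finite_edges edge_ends_distinct mM])
      (use core_covers_edge[OF y(1)] in auto)
  \<comment> \<open>Strict because \<open>q\<close> is not among the matched vertices and
    \<open>y q > 0\<close>.\<close>
  also have "\<dots> < sum y (U \<union> V)"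
  proof (rule sum_strict_mono2)
    show "{q. matched M q} \<subseteq> U \<union> V"
      using mM edges by (auto simp: matching_def matched_def endpoints_def)
  qed (use imp q y(2) unmatched finite_U finite_V in auto)
  finally show False
    using imp(2) by simp
qed

lemma essential_imp_paid_sometimes:
  assumes q: "q \<in> U \<union> V" and ess: "essential E w q"
  shows "paid_sometimes U V E w q"
proof -
  obtain \<delta> where \<delta>: "\<delta> > 0"
    "\<And>M N. max_weight_matching E w M \<Longrightarrow> max_weight_matching E (discount w q \<delta>) N
      \<Longrightarrow> weight w M = weight (discount w q \<delta>) N + \<delta>"
    using obtain_discount[OF finite_edges, of w q] ess by metis
  obtain y where y: "optimal_cover (U \<union> V) E (discount w q \<delta>) y"
    using optimal_cover_exists[OF finite_U finite_V edges disjoint] by blast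
  then have "optimal_cover (U \<union> V) E w (y(q := y q + \<delta>))"
    by (intro optimal_cover_discount) (use finite_U finite_V finite_edges q \<delta> in auto)
  then have "y(q := y q + \<delta>) \<in> core U V E w"
    by (rule optimal_cover_in_core)
  moreover have "y q + \<delta> > 0"
    using y q \<delta>(1) by (force simp: optimal_cover_def)
  ultimately show ?thesis
    unfolding paid_sometimes_def by (metis fun_upd_same)
qed

end

theorem theorem3:
  fixes U V :: "'a set" and E :: "('a \<times> 'a) set" and w :: "'a \<times> 'a \<Rightarrow> real" and q :: 'a
  assumes "assignment_game U V E w"
    and "q \<in> U \<union> V"
  shows "paid_sometimes U V E w q \<longleftrightarrow> essential E w q"
  using assignment_game.paid_sometimes_imp_essential[OF assms]
    assignment_game.essential_imp_paid_sometimes[OF assms] ..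

end
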